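(* Let $d=2$ and assume that the potential $f$ is differentiable on $(0,1)$, as well as decreasing and logarithmically convex on $(0,1/2]$. Then there exists $a\in(0,1/4)$ such that the point configuration $$X_a^{(6)}=\left\{(0,0),\ (a,\tfrac12-a),\ (2a,1-2a),\ (\tfrac12,\tfrac12-2a),\ (a+\tfrac12,1-a),\ (\tfrac12+2a,\tfrac12)\right\}$$ is a minimizer of $E_F$ among all $6$-point configurations in $\mathbb T^2$ with the same permutation type. This value of $a$ satisfies $$f'(a)f(1/2-a)+f'(2a)f(2a)=f'(1/2-a)f(a)+f'(1/2-2a)f(1/2).$$ If $f$ is strictly logarithmically convex, this value of $a$ is unique.
   Context: $\mathbb T=\mathbb R/\mathbb Z$ is identified with $[0,1)$. A potential $f$ on $\mathbb T$ is viewed as a nonnegative even $1$-periodic function on $\mathbb R$, continuous on $(0,1)$; moreover either $f$ is continuous on all of $\mathbb R$, or it is singular at $0$, i.e. $\lim_{t\to0}f(t)=+\infty$ and $f(0)=+\infty$. "Decreasing" means non-increasing; (strictly) logarithmically convex means $f>0$ and $\log f$ is (strictly) convex on $(0,1/2]$. Energy: $F(t_1,t_2)=f(t_1)f(t_2)$ and, for a (multi)set $X=\{\mathbf x^0,\dots,\mathbf x^{N-1}\}\subset\mathbb T^2$, $E_F(X)=\sum_{k,\ell=0,\,k\ne\ell}^{N-1}f(x_1^k-x_1^\ell)f(x_2^k-x_2^\ell)$. Permutation type: for a configuration $\{\mathbf x^0,\dots,\mathbf x^{N-1}\}\subset\mathbb T^2\simeq[0,1)^2$, a pair $(\sigma_1,\sigma_2)$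 of permutations of $\{0,\dots,N-1\}$ is a permutation type if $x_i^{\sigma_i^{-1}(0)}\le x_i^{\sigma_i^{-1}(1)}\le\dots\le x_i^{\sigma_i^{-1}(N-1)}$ for $i=1,2$; points are labelled in order of their first coordinate, so that $\sigma_1=\mathrm{id}$, and translated so that $\mathbf x^0=(0,0)$. For $a\in(0,1/4)$ the points of $X_a^{(6)}$ are listed in order of first coordinate, and its permutation type does not depend on $a$. A configuration "has the same permutation type" if this pair is a permutation type of it. *)

theory Defs
  imports "HOL-Analysis.Analysis"
begin

text \<open>Potentials take values in \<open>[0,\<infinity>]\<close>; the value \<open>\<infinity>\<close> is attained at most at the integers.
  The two alternatives are the continuous real-valued and the singular case.\<close>

definition potential :: "(real \<Rightarrow> ennreal) \<Rightarrow> bool" where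
  "potential f \<longleftrightarrow>
     (\<forall>t. f (- t) = f t) \<and> (\<forall>t. f (t + 1) = f t) \<and>
     (\<forall>t\<in>{0<..<1}. f t < \<infinity>) \<and> continuous_on {0<..<1} f \<and>
     (((\<forall>t. f t < \<infinity>) \<and> continuous_on UNIV f) \<or> ((f \<longlongrightarrow> \<infinity>) (at 0) \<and> f 0 = \<infinity>))"

text \<open>Real-valued version of a potential, meaningful wherever \<open>f t < \<infinity>\<close>, in particular on \<open>(0,1)\<close>.\<close>

definition real_val :: "(real \<Rightarrow> ennreal) \<Rightarrow> real \<Rightarrow> real" where
  "real_val f t = enn2real (f t)"

definition strictly_convex_on :: "real set \<Rightarrow> (real \<Rightarrow> real) \<Rightarrow> bool" where
  "strictly_convex_on S g \<longleftrightarrow> convex S \<and>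
     (\<forall>x\<in>S. \<forall>y\<in>S. x \<noteq> y \<longrightarrow>
        (\<forall>u>0. \<forall>v>0. u + v = 1 \<longrightarrow> g (u * x + v * y) < u * g x + v * g y))"

definition log_convex :: "(real \<Rightarrow> ennreal) \<Rightarrow> bool" where
  "log_convex f \<longleftrightarrow> (\<forall>t\<in>{0<..1/2}. f t > 0) \<and> convex_on {0<..1/2} (\<lambda>t. ln (real_val f t))"

definition strictly_log_convex :: "(real \<Rightarrow> ennreal) \<Rightarrow> bool" where
  "strictly_log_convex f \<longleftrightarrow>
     (\<forall>t\<in>{0<..1/2}. f t > 0) \<and> strictly_convex_on {0<..1/2} (\<lambda>t. ln (real_val f t))"

definition tensor_potential :: "(real \<Rightarrow> ennreal) \<Rightarrow> real \<times> real \<Rightarrow> ennreal" where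
  "tensor_potential f = (\<lambda>(t1, t2). f t1 * f t2)"

text \<open>An \<open>N\<close>-point configuration is a labelled family \<open>x 0, \<dots>, x (N - 1)\<close>, so points may be
  repeated; values at indices \<open>\<ge> N\<close> are irrelevant.  The torus is represented by \<open>[0,1)\<^sup>2\<close>.\<close>

definition torus_config :: "nat \<Rightarrow> (nat \<Rightarrow> real \<times> real) \<Rightarrow> bool" where
  "torus_config N x \<longleftrightarrow> (\<forall>k<N. x k \<in> {0..<1} \<times> {0..<1})"

definition energy :: "(real \<times> real \<Rightarrow> ennreal) \<Rightarrow> nat \<Rightarrow> (nat \<Rightarrow> real \<times> real) \<Rightarrow> ennreal" where
  "energy F N x = (\<Sum>k<N. \<Sum>l\<in>{..<N} - {k}. F (x k - x l))"

definition perm_type ::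
    "nat \<Rightarrow> (nat \<Rightarrow> real \<times> real) \<Rightarrow> (nat \<Rightarrow> nat) \<Rightarrow> (nat \<Rightarrow> nat) \<Rightarrow> bool" where
  "perm_type N x \<sigma>1 \<sigma>2 \<longleftrightarrow>
     \<sigma>1 permutes {..<N} \<and> \<sigma>2 permutes {..<N} \<and>
     mono_on {..<N} (\<lambda>j. fst (x (inv \<sigma>1 j))) \<and>
     mono_on {..<N} (\<lambda>j. snd (x (inv \<sigma>2 j)))"

text \<open>Ties allow a configuration to have several permutation types.  If the coordinates of \<open>x\<close> are
  pairwise distinct, as for the six-point configuration below, its type is unique, and the
  existential quantifier says that this type is one of the types of \<open>y\<close>.\<close>

definition same_perm_type ::
    "nat \<Rightarrow> (nat \<Rightarrow> real \<times> real) \<Rightarrow> (nat \<Rightarrow> real \<times> real) \<Rightarrow> bool" where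
  "same_perm_type N x y \<longleftrightarrow> (\<exists>\<sigma>1 \<sigma>2. perm_type N x \<sigma>1 \<sigma>2 \<and> perm_type N y \<sigma>1 \<sigma>2)"

text \<open>Competitors are not required to satisfy \<open>y 0 = (0,0)\<close>: the energy is invariant under
  translation, so this normalization is immaterial.\<close>

definition minimizer_in_perm_type ::
    "(real \<times> real \<Rightarrow> ennreal) \<Rightarrow> nat \<Rightarrow> (nat \<Rightarrow> real \<times> real) \<Rightarrow> bool" where
  "minimizer_in_perm_type F N x \<longleftrightarrow>
     torus_config N x \<and>
     (\<forall>y. torus_config N y \<and> same_perm_type N x y \<longrightarrow> energy F N x \<le> energy F N y)"

definition X6 :: "real \<Rightarrow> nat \<Rightarrow> real \<times> real" where
  "X6 a k = [(0, 0), (a, 1/2 - a), (2 * a, 1 - 2 * a), (1/2, 1/2 - 2 * a),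
             (a + 1/2, 1 - a), (1/2 + 2 * a, 1/2)] ! k"

end

theory Submission
  imports Defs
begin

text \<open>Since \<open>f\<close> is decreasing on \<open>(0,1/2]\<close> and symmetric about \<open>1/2\<close>, \<open>log f\<close> is convex on all of
  \<open>(0,1)\<close>.  On a fixed permutation type every coordinate difference keeps its sign, so each term of
  the energy is the exponential of a convex function and lies above its tangent plane at
  \<open>X6 a\<close>.  Adding the tangent planes of all pairs, the linear parts cancel exactly when the slope
  \<open>f'(a) f(1/2 - a) + f'(2a) f(2a) - f'(1/2 - a) f(a) - f'(1/2 - 2a) f(1/2)\<close>, which is \<open>1/16\<close> of the
  derivative of the energy along the family \<open>X6\<close>, vanishes.  The slope is continuous, non-positive
  at \<open>1/8\<close> and, unless \<open>f\<close> is constant on \<open>(0,1)\<close>, positive near \<open>1/4\<close>, so it has a zero.  Under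
  strict convexity the tangent inequality along \<open>X6\<close> is strict, which leaves room for only one
  minimizer.\<close>

section \<open>Permutation types and energies of six labelled points\<close>

lemma perm_type_mono:
  assumes x: "perm_type N x \<sigma>1 \<sigma>2" and y: "perm_type N y \<sigma>1 \<sigma>2" and kl: "k < N" "l < N"
  shows "fst (x k) < fst (x l) \<Longrightarrow> fst (y k) \<le> fst (y l)"
    and "snd (x k) < snd (x l) \<Longrightarrow> snd (y k) \<le> snd (y l)"
proof -
  have *: "p (y k) \<le> p (y l)"
    if s: "\<sigma> permutes {..<N}" and mx: "mono_on {..<N} (\<lambda>j. p (x (inv \<sigma> j)))"
      and my: "mono_on {..<N} (\<lambda>j. p (y (inv \<sigma> j)))" and lt: "p (x k) < p (x l)"
    for p :: "real \<times> real \<Rightarrow> real" and \<sigma>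
  proof -
    have i: "inv \<sigma> (\<sigma> k) = k" "inv \<sigma> (\<sigma> l) = l"
      using permutes_inverses(2)[OF s] by auto
    have m: "\<sigma> k \<in> {..<N}" "\<sigma> l \<in> {..<N}"
      using permutes_in_image[OF s] kl by auto
    \<comment> \<open>A strict inequality in \<open>x\<close> fixes the order of the ranks. Since
      \<open>y\<close> shares the ranks but may have ties, only the weak inequality carries over to
      it.\<close>
    have "\<not> \<sigma> l \<le> \<sigma> k"
      using mono_onD[OF mx m(2) m(1)] lt by (auto simp: i)
    then show ?thesis
      using mono_onD[OF my m] by (simp add: i)
  qed
  show "fst (x k) < fst (x l) \<Longrightarrow> fst (y k) \<le> fst (y l)"
    and "snd (x k) < snd (x l) \<Longrightarrow> snd (y k) \<le> snd (y l)"
    using *[of \<sigma>1 fst] *[of \<sigma>2 snd] x y by (auto simp: perm_type_def)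
qed

lemma lessThan_6: "{..<6} = {0, 1, 2, 3, 4, 5::nat}"
  by auto

lemma X6_simps [simp]:
  "X6 a 0 = (0, 0)" "X6 a 1 = (a, 1/2 - a)" "X6 a (Suc 0) = (a, 1/2 - a)"
  "X6 a 2 = (2 * a, 1 - 2 * a)"
  "X6 a 3 = (1/2, 1/2 - 2 * a)" "X6 a 4 = (a + 1/2, 1 - a)" "X6 a 5 = (1/2 + 2 * a, 1/2)"
  by (simp_all add: X6_def)

lemma torus_config_X6: "0 < a \<Longrightarrow> a < 1/4 \<Longrightarrow> torus_config 6 (X6 a)"
  unfolding torus_config_def Ball_def[of "{..<6}", unfolded lessThan_iff, symmetric]
  by (simp add: lessThan_6)

text \<open>This makes the members of the family competitors of each other, so that a minimizing
  parameter also minimizes the energy along the family.\<close>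

lemma same_perm_type_X6:
  assumes "0 < a" "a < 1/4" "0 < b" "b < 1/4"
  shows "same_perm_type 6 (X6 a) (X6 b)"
proof -
  \<comment> \<open>\<open>\<sigma>\<close> gives the rank of each point by second coordinate. Its
    inverse \<open>\<tau>\<close> lists the points as 0, 3, 1, 5, 2, 4, with heights 0 < 1/2 - 2a <
    1/2 - a < 1/2 < 1 - 2a < 1 - a.\<close>
  define \<sigma> :: "nat \<Rightarrow> nat" where "\<sigma> k = (if k < 6 then [0,2,4,1,5,3] ! k else k)" for k
  define \<tau> :: "nat \<Rightarrow> nat" where "\<tau> k = (if k < 6 then [0,3,1,5,2,4] ! k else k)" for k
  have *: "k = 0 \<or> k = 1 \<or> k = 2 \<or> k = 3 \<or> k = 4 \<or> k = 5 \<or> \<not> k < 6" for k :: nat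
    by linarith
  have \<tau>\<sigma>: "\<tau> (\<sigma> k) = k" for k
    using *[of k] by (elim disjE) (simp_all add: \<sigma>_def \<tau>_def)
  have \<sigma>\<tau>: "\<sigma> (\<tau> k) = k" for k
    using *[of k] by (elim disjE) (simp_all add: \<sigma>_def \<tau>_def)
  have inv: "inv \<sigma> = \<tau>"
    by (rule inv_equality) (simp_all add: \<tau>\<sigma> \<sigma>\<tau>)
  have "\<sigma> permutes {..<6}"
    unfolding permutes_def
  proof (intro conjI allI impI)
    show "\<exists>!x. \<sigma> x = y" for y
      by (metis \<tau>\<sigma> \<sigma>\<tau>)
  qed (simp add: \<sigma>_def)
  moreover have "mono_on {..<6} (\<lambda>j. fst (X6 c j))" "mono_on {..<6} (\<lambda>j. snd (X6 c (\<tau> j)))"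
    if "0 < c" "c < 1/4" for c
    using that by (auto simp: mono_on_def lessThan_6 \<tau>_def)
  ultimately have "perm_type 6 (X6 c) id \<sigma>" if "0 < c" "c < 1/4" for c
    using that by (simp add: perm_type_def inv permutes_id)
  then show ?thesis
    using assms unfolding same_perm_type_def by blast
qed

text \<open>The right-nested sum over unordered pairs lets later estimates be applied summand by
  summand.\<close>

lemma energy_6:
  assumes even: "\<And>u. F (- u) = F u"
  shows "energy F 6 x = 2 *
    (F (x 1 - x 0) + (F (x 2 - x 0) + (F (x 3 - x 0) + (F (x 4 - x 0) + (F (x 5 - x 0) +
    (F (x 2 - x 1) + (F (x 3 - x 1) + (F (x 4 - x 1) + (F (x 5 - x 1) +
    (F (x 3 - x 2) + (F (x 4 - x 2) + (F (x 5 - x 2) +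
    (F (x 4 - x 3) + (F (x 5 - x 3) + F (x 5 - x 4)))))))))))))))"
proof -
  have swap: "F (x k - x l) = F (x l - x k)" for k l
    using even[of "x l - x k"] by simp
  show ?thesis
    unfolding energy_def lessThan_6
    by (simp add: insert_Diff_if mult_2 add_ac
        swap[of 0 "Suc 0"] swap[of 0 2] swap[of 0 3] swap[of 0 4] swap[of 0 5]
        swap[of "Suc 0" 2] swap[of "Suc 0" 3] swap[of "Suc 0" 4] swap[of "Suc 0" 5]
        swap[of 2 3] swap[of 2 4] swap[of 2 5] swap[of 3 4] swap[of 3 5] swap[of 4 5])
qed

text \<open>No sign condition on \<open>a\<close> and \<open>b\<close>: \<open>ennreal\<close> sends
  negative numbers to 0, which can only increase the sum on the right. Tangent planes may well take
  negative values.\<close>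

lemma ennreal_add_le: "ennreal a \<le> A \<Longrightarrow> ennreal b \<le> B \<Longrightarrow> ennreal (a + b) \<le> A + B"
  by (rule order.trans[OF _ add_mono]) (auto simp: ennreal_plus_if not_le intro!: ennreal_leI)

text \<open>Monotonicity of the slopes confines \<open>g'\<close> near \<open>c\<close> between its values at \<open>c \<plusminus> k\<close>, which the
  tangent inequalities compare with difference quotients of \<open>g\<close> close to \<open>g' c\<close>.\<close>

lemma isCont_slope_of_tangents:
  fixes g g' :: "real \<Rightarrow> real"
  assumes "open A" "c \<in> A" and D: "(g has_real_derivative g' c) (at c)"
    and tangent: "\<And>x y. x \<in> A \<Longrightarrow> y \<in> A \<Longrightarrow> g x + g' x * (y - x) \<le> g y"
  shows "isCont g' c"
  unfolding continuous_at_real_range real_norm_def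
proof (intro allI impI)
  fix e :: real assume e: "0 < e"
  obtain r where r: "0 < r" "ball c r \<subseteq> A"
    using assms(1,2) openE by blast
  from D have "(g has_derivative (\<lambda>h. g' c * h)) (at c)"
    by (simp add: has_field_derivative_def)
  then have "\<forall>e>0. \<exists>d>0. \<forall>y. norm (y - c) < d \<longrightarrow>
      norm (g y - g c - g' c * (y - c)) \<le> e * norm (y - c)"
    unfolding has_derivative_at_alt by simp
  moreover have "0 < e / 4"
    using e by simp
  ultimately obtain d where d: "0 < d"
    "\<And>y. norm (y - c) < d \<Longrightarrow> norm (g y - g c - g' c * (y - c)) \<le> e / 4 * norm (y - c)"
    by blast
  \<comment> \<open>The points c + 2k and c - 2k must lie in \<open>A\<close> and in the range of
    the e/4 estimate. The errors at distances k and 2k then add up to 3/4 e k, which is less than e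
    k.\<close>
  define k where "k = min d r / 3"
  have k: "0 < k" "2 * k < d" "2 * k < r"
    using d(1) r(1) by (auto simp: k_def)
  have inA: "y \<in> A" if "\<bar>y - c\<bar> \<le> 2 * k" for y
    using r(2) that k by (auto simp: dist_real_def)
  have q: "\<bar>g y - g c - g' c * (y - c)\<bar> \<le> e / 4 * \<bar>y - c\<bar>" if "\<bar>y - c\<bar> \<le> 2 * k" for y
    using d(2)[of y] that k by simp
  have mono: "g' x \<le> g' y" if "x \<in> A" "y \<in> A" "x < y" for x y
  proof -
    have "g' x * (y - x) \<le> g' y * (y - x)"
      using tangent[of x y] tangent[of y x] that by (simp add: algebra_simps)
    then show ?thesis
      using that by simp
  qed
  have t: "g (c + k) + g' (c + k) * k \<le> g (c + 2 * k)" "g (c - k) - g' (c - k) * k \<le> g (c - 2 * k)"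
    using tangent[OF inA inA, of "c + k" "c + 2 * k"] tangent[OF inA inA, of "c - k" "c - 2 * k"] k
    by (simp_all add: algebra_simps)
  have u: "\<bar>g (c + k) - g c - g' c * k\<bar> \<le> e / 4 * k"
    "\<bar>g (c + 2 * k) - g c - 2 * (g' c * k)\<bar> \<le> e / 2 * k"
    "\<bar>g (c - k) - g c + g' c * k\<bar> \<le> e / 4 * k"
    "\<bar>g (c - 2 * k) - g c + 2 * (g' c * k)\<bar> \<le> e / 2 * k"
    using q[of "c + k"] q[of "c + 2 * k"] q[of "c - k"] q[of "c - 2 * k"] k
    by (simp_all add: algebra_simps)
  have up: "(g' (c + k) - g' c) * k \<le> 3 / 4 * e * k"
    using t(1) u(1,2) unfolding abs_le_iff left_diff_distrib by linarith
  have lo: "(g' c - g' (c - k)) * k \<le> 3 / 4 * e * k"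
    using t(2) u(3,4) unfolding abs_le_iff left_diff_distrib by linarith
  have bnd: "g' (c + k) - g' c < e" "g' c - g' (c - k) < e"
    using up lo k(1) e by (auto simp: mult_le_cancel_right)
  show "\<exists>s>0. \<forall>x. \<bar>x - c\<bar> < s \<longrightarrow> \<bar>g' x - g' c\<bar> < e"
  proof (intro exI[of _ k] conjI allI impI)
    fix x assume x: "\<bar>x - c\<bar> < k"
    have "g' (c - k) \<le> g' x" "g' x \<le> g' (c + k)"
      using x k by (auto intro!: mono inA)
    with bnd show "\<bar>g' x - g' c\<bar> < e"
      by (simp add: abs_less_iff)
  qed (rule k(1))
qed

section \<open>Symmetry, positivity and derivatives of the potential\<close>

locale log_convex_potential =
  fixes f :: "real \<Rightarrow> ennreal"
  assumes potential: "potential f"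
    and differentiable: "real_val f differentiable_on {0<..<1}"
    and antimono: "antimono_on {0<..1/2} f"
    and log_convex: "log_convex f"
begin

abbreviation h :: "real \<Rightarrow> real" where "h \<equiv> real_val f"

abbreviation h' :: "real \<Rightarrow> real" where "h' \<equiv> deriv h"

definition slope :: "real \<Rightarrow> real" where "slope a =
  h' a * h (1/2 - a) + h' (2 * a) * h (2 * a) - h' (1/2 - a) * h a - h' (1/2 - 2 * a) * h (1/2)"

text \<open>After reduction by the symmetries of \<open>f\<close>, the 15 unordered pairs of points
  fall into classes of sizes 8, 2, 4 and 1; ordered pairs double these numbers.\<close>

definition X6_energy :: "real \<Rightarrow> real" where "X6_energy a =
  16 * (h a * h (1/2 - a)) + 4 * (h (2 * a) * h (2 * a)) + 8 * (h (1/2) * h (1/2 - 2 * a))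
  + 2 * (h (1/2) * h (1/2))"

lemma f_minus: "f (- t) = f t"
  using potential by (simp add: potential_def)

lemma f_reflect: "f (1 - t) = f t"
proof -
  have "f (- t + 1) = f (- t)"
    using potential by (simp only: potential_def)
  then show ?thesis
    by (simp add: f_minus)
qed

lemma h_reflect: "h (1 - t) = h t"
  by (simp add: real_val_def f_reflect)

lemma h_half_plus: "h (1/2 + t) = h (1/2 - t)"
  using h_reflect[of "1/2 - t"] by simp

lemma f_eq: "0 < t \<Longrightarrow> t < 1 \<Longrightarrow> f t = ennreal (h t)"
  using potential by (simp add: potential_def real_val_def)

lemma h_pos:
  assumes "0 < t" "t < 1"
  shows "0 < h t"
proof -
  have "0 < f t"
  proof (cases "t \<le> 1/2")
    case True
    then show ?thesis
      using log_convex assms by (simp add: log_convex_def)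
  next
    case False
    then have "0 < f (1 - t)"
      using log_convex assms by (simp add: log_convex_def)
    then show ?thesis
      by (simp add: f_reflect)
  qed
  then show ?thesis
    using f_eq[OF assms] by simp
qed

lemma h_antimono: "0 < s \<Longrightarrow> s \<le> t \<Longrightarrow> t \<le> 1/2 \<Longrightarrow> h t \<le> h s"
  using monotone_onD[OF antimono, of s t] f_eq[of s] f_eq[of t] h_pos[of s] by simp

lemma h_half_le: "0 < t \<Longrightarrow> t < 1 \<Longrightarrow> h (1/2) \<le> h t"
  using h_antimono[of t "1/2"] h_antimono[of "1 - t" "1/2"] by (cases "t \<le> 1/2") (auto simp: h_reflect)

lemma DERIV_h: "0 < t \<Longrightarrow> t < 1 \<Longrightarrow> (h has_real_derivative h' t) (at t)"
  using differentiable
  by (metis DERIV_deriv_iff_real_differentiable at_within_open differentiable_on_def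
      greaterThanLessThan_iff open_greaterThanLessThan)

lemma DERIV_h_chain [derivative_intros]:
  "(u has_real_derivative u') (at x) \<Longrightarrow> 0 < u x \<Longrightarrow> u x < 1 \<Longrightarrow>
    ((\<lambda>x. h (u x)) has_real_derivative h' (u x) * u') (at x)"
  by (rule DERIV_chain2[OF DERIV_h])

lemma h'_reflect:
  assumes "0 < t" "t < 1"
  shows "h' (1 - t) = - h' t"
proof -
  have "((\<lambda>t. h (1 - t)) has_real_derivative h' (1 - t) * (- 1)) (at t)"
    using assms by (auto intro!: derivative_eq_intros)
  then have "(h has_real_derivative h' (1 - t) * (- 1)) (at t)"
    by (simp add: h_reflect)
  then show ?thesis
    using DERIV_unique[OF DERIV_h[OF assms]] by force
qed

lemma h'_half_plus: "- 1/2 < t \<Longrightarrow> t < 1/2 \<Longrightarrow> h' (1/2 + t) = - h' (1/2 - t)"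
  using h'_reflect[of "1/2 - t"] by simp

lemma h'_half: "h' (1/2) = 0"
  using h'_reflect[of "1/2"] by simp

section \<open>Tangent inequalities for \<open>ln h\<close> and for products\<close>

lemma DERIV_ln_h: "0 < t \<Longrightarrow> t < 1 \<Longrightarrow> ((\<lambda>t. ln (h t)) has_real_derivative h' t / h t) (at t)"
  by (auto intro!: derivative_eq_intros simp: h_pos)

lemma tangent_aux:
  assumes s: "0 < s" "s < 1/2" and t: "0 < t" "t \<le> 1/2"
  shows "ln (h s) + h' s / h s * (t - s) \<le> ln (h t)"
proof -
  have "h' s / h s * (t - s) \<le> ln (h t) - ln (h s)"
    using s t log_convex
    by (intro convex_on_imp_above_tangent[of "{0<..1/2}"] has_field_derivative_at_within[OF DERIV_ln_h])
      (auto simp: log_convex_def intro!: interiorI[of "{0<..<1/2}"])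
  then show ?thesis by simp
qed

lemma h'_nonpos:
  assumes "0 < s" "s \<le> 1/2"
  shows "h' s \<le> 0"
proof (cases "s = 1/2")
  case False
  with assms have s: "0 < s" "s < 1/2"
    by auto
  have "h' s / h s * (1/2 - s) \<le> ln (h (1/2)) - ln (h s)"
    using tangent_aux[OF s, of "1/2"] by simp
  also have "\<dots> \<le> 0"
    using h_antimono[of s "1/2"] s h_pos[of s] h_pos[of "1/2"] by simp
  finally show ?thesis
    using s h_pos[of s] by (auto simp: mult_le_0_iff divide_le_0_iff)
next
  case True
  show ?thesis
    unfolding True h'_half by simp
qed

text \<open>For s < 1/2 < t, the tangent at s has non-positive slope, so its value at t is at most
  its value at 1 - t, where the convexity hypothesis applies. The case s > 1/2 follows by
  reflection, and at s = 1/2 the tangent is horizontal and \<open>h\<close> is minimal.\<close>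

lemma tangent:
  assumes s: "0 < s" "s < 1" and t: "0 < t" "t < 1"
  shows "ln (h s) + h' s / h s * (t - s) \<le> ln (h t)"
proof -
  have half: "ln (h s) + h' s / h s * (t - s) \<le> ln (h t)"
    if s: "0 < s" "s < 1/2" and t: "0 < t" "t < 1" for s t
  proof (cases "t \<le> 1/2")
    case False
    have "h' s / h s * (t - s) \<le> h' s / h s * (1 - t - s)"
      using False s h'_nonpos[of s] h_pos[of s]
      by (intro mult_left_mono_neg) (auto simp: divide_le_0_iff)
    also have "\<dots> \<le> ln (h t) - ln (h s)"
      using tangent_aux[OF s, of "1 - t"] False t by (simp add: h_reflect)
    finally show ?thesis by simp
  qed (use tangent_aux[OF s] t in simp)
  consider "s < 1/2" | "s = 1/2" | "s > 1/2"
    by linarith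
  then show ?thesis
  proof cases
    case 2
    show ?thesis
      unfolding 2 using h_half_le[OF t] h_pos[of "1/2"] h_pos[OF t] by (simp add: h'_half)
  next
    case 3
    then show ?thesis
      using half[of "1 - s" "1 - t"] s t by (simp add: h_reflect h'_reflect diff_divide_distrib algebra_simps)
  qed (use half s t in simp)
qed

text \<open>In the singular case this is continuity as a map into \<open>[0,\<infinity>]\<close>; it lets the lower bound below
  include coinciding coordinates, \<open>t = 0\<close>.\<close>

lemma isCont_f_0: "isCont f 0"
  using potential unfolding potential_def isCont_def
  by (auto simp: continuous_on_eq_continuous_at isCont_def)

lemma f_lower_bound:
  assumes s: "0 < s" "s < 1" and t: "0 \<le> t" "t < 1"
  shows "ennreal (h s * exp (h' s / h s * (t - s))) \<le> f t"
proof -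
  have *: "ennreal (h s * exp (h' s / h s * (t - s))) \<le> f t" if "0 < t" "t < 1" for t
  proof -
    have "exp (ln (h s) + h' s / h s * (t - s)) \<le> exp (ln (h t))"
      using tangent[OF s that] by simp
    then show ?thesis
      using that s by (simp add: f_eq h_pos exp_add ennreal_leI)
  qed
  show ?thesis
  proof (cases "t = 0")
    case True
    have "((\<lambda>t. ennreal (h s * exp (h' s / h s * (t - s)))) \<longlongrightarrow>
        ennreal (h s * exp (h' s / h s * (0 - s)))) (at_right 0)"
      by (intro tendsto_intros)
    moreover have "(f \<longlongrightarrow> f 0) (at_right 0)"
      using isCont_f_0 by (simp add: isCont_def filterlim_at_split)
    moreover have "\<forall>\<^sub>F t in at_right (0::real). ennreal (h s * exp (h' s / h s * (t - s))) \<le> f t"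
      by (rule eventually_at_rightI[of 0 1]) (auto intro: * simp del: times_divide_eq_left)
    ultimately show ?thesis
      unfolding True by (intro tendsto_le[of "at_right (0::real)"]) auto
  qed (use * t in simp)
qed

text \<open>The product of two exponential lower bounds is the exponential of an affine function,
  which 1 + x \<le> exp x makes linear. The points s' and t' may be 0 because competitors may share
  coordinates.\<close>

lemma product_tangent:
  assumes s: "0 < s" "s < 1" "0 \<le> s'" "s' < 1" and t: "0 < t" "t < 1" "0 \<le> t'" "t' < 1"
  shows "ennreal (h s * h t + h' s * h t * (s' - s) + h s * h' t * (t' - t)) \<le> f s' * f t'"
proof -
  let ?u = "h' s / h s * (s' - s)" and ?v = "h' t / h t * (t' - t)"
  have pos: "0 < h s" "0 < h t"
    using s t by (auto intro: h_pos)
  have "h s * h t + h' s * h t * (s' - s) + h s * h' t * (t' - t) = h s * h t * (1 + (?u + ?v))"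
    using pos by (simp add: field_simps)
  also have "\<dots> \<le> h s * h t * exp (?u + ?v)"
    using pos by (intro mult_left_mono exp_ge_add_one_self) auto
  also have "\<dots> = (h s * exp ?u) * (h t * exp ?v)"
    by (simp add: exp_add)
  finally have "ennreal (h s * h t + h' s * h t * (s' - s) + h s * h' t * (t' - t)) \<le>
      ennreal (h s * exp ?u) * ennreal (h t * exp ?v)"
    using pos by (simp add: ennreal_leI flip: ennreal_mult)
  also have "\<dots> \<le> f s' * f t'"
    using s t by (intro mult_mono f_lower_bound) auto
  finally show ?thesis .
qed

lemma log_slope_mono:
  assumes "0 < s" "s \<le> t" "t < 1"
  shows "h' s / h s \<le> h' t / h t"
proof (cases "s = t")
  case False
  have "h' s / h s * (t - s) \<le> h' t / h t * (t - s)"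
    using tangent[of s t] tangent[of t s] assms
    unfolding right_diff_distrib by linarith
  then show ?thesis
    by (rule mult_right_le_imp_le) (use False assms in simp)
qed simp

lemma isCont_h: "0 < t \<Longrightarrow> t < 1 \<Longrightarrow> isCont h t"
  by (rule DERIV_isCont[OF DERIV_h])

text \<open>Convexity upgrades differentiability to a continuous logarithmic derivative, and
  multiplying by \<open>h\<close> recovers \<open>h'\<close>. The intermediate value argument for
  \<open>slope\<close> rests on this.\<close>

lemma isCont_h':
  assumes "0 < t" "t < 1"
  shows "isCont h' t"
proof -
  have "isCont (\<lambda>t. h' t / h t) t"
    using assms by (intro isCont_slope_of_tangents[of "{0<..<1}" t "\<lambda>t. ln (h t)"] DERIV_ln_h tangent) auto
  then have "isCont (\<lambda>t. h' t / h t * h t) t"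
    using assms by (intro continuous_mult isCont_h)
  moreover have "\<forall>\<^sub>F t in nhds t. h' t / h t * h t = h' t"
    using eventually_nhds_in_open[of "{0<..<1}" t] assms
    by (auto elim!: eventually_mono dest: h_pos)
  ultimately show ?thesis
    using isCont_cong[of "\<lambda>t. h' t / h t * h t" h' t] by simp
qed

lemma isCont_h_chain: "isCont u x \<Longrightarrow> 0 < u x \<Longrightarrow> u x < 1 \<Longrightarrow> isCont (\<lambda>x. h (u x)) x"
  by (rule isCont_o2[OF _ isCont_h])

lemma isCont_h'_chain: "isCont u x \<Longrightarrow> 0 < u x \<Longrightarrow> u x < 1 \<Longrightarrow> isCont (\<lambda>x. h' (u x)) x"
  by (rule isCont_o2[OF _ isCont_h'])

lemma product_tangent_real:
  assumes "0 < s" "s < 1" "0 < s'" "s' < 1" "0 < t" "t < 1" "0 < t'" "t' < 1"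
  shows "h s * h t + h' s * h t * (s' - s) + h s * h' t * (t' - t) \<le> h s' * h t'"
  using product_tangent[of s s' t t'] assms h_pos[of s'] h_pos[of t']
  by (simp add: f_eq flip: ennreal_mult)

section \<open>The energy of \<open>X6 a\<close>, and its minimality at a zero of
  \<open>slope\<close>\<close>

lemma tensor_minus: "tensor_potential f (- u) = tensor_potential f u"
  by (cases u) (simp add: tensor_potential_def f_minus)

lemma energy_X6:
  assumes a: "0 < a" "a < 1/4"
  shows "energy (tensor_potential f) 6 (X6 a) = ennreal (X6_energy a)"
proof -
  have pos: "0 \<le> h a" "0 \<le> h (1/2 - a)" "0 \<le> h (2 * a)" "0 \<le> h (1/2 - 2 * a)" "0 \<le> h (1/2)"
    using a by (auto intro!: less_imp_le h_pos)
  have swap: "f (s - t) = ennreal (h (t - s))" if "s < t" "t < s + 1" for s t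
    using f_minus[of "t - s"] f_eq[of "t - s"] that by simp
  have "energy (tensor_potential f) 6 (X6 a) = 2 *
    (ennreal (h a * h (1/2 - a)) + (ennreal (h (2 * a) * h (2 * a)) +
    (ennreal (h (1/2) * h (1/2 - 2 * a)) + (ennreal (h (1/2 - a) * h a) +
    (ennreal (h (1/2 - 2 * a) * h (1/2)) + (ennreal (h a * h (1/2 - a)) +
    (ennreal (h (1/2 - a) * h a) + (ennreal (h (1/2) * h (1/2)) +
    (ennreal (h (1/2 - a) * h a) + (ennreal (h (1/2 - 2 * a) * h (1/2)) +
    (ennreal (h (1/2 - a) * h a) + (ennreal (h (1/2) * h (1/2 - 2 * a)) +
    (ennreal (h a * h (1/2 - a)) + (ennreal (h (2 * a) * h (2 * a)) +
    ennreal (h a * h (1/2 - a))))))))))))))))"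
    unfolding energy_6[of "tensor_potential f", OF tensor_minus]
    by (intro arg_cong2[where f = plus] arg_cong2[where f = times] refl)
      (use a in \<open>simp_all add: tensor_potential_def f_eq swap f_minus h_reflect h_half_plus add.commute[of a]
        ennreal_mult pos\<close>)
  also have "\<dots> = ennreal (X6_energy a)"
    using pos by (simp add: X6_energy_def flip: ennreal_plus ennreal_numeral ennreal_mult'')
  finally show ?thesis .
qed

lemma X6_minimizer:
  assumes a: "0 < a" "a < 1/4" and crit: "slope a = 0"
  shows "minimizer_in_perm_type (tensor_potential f) 6 (X6 a)"
  unfolding minimizer_in_perm_type_def
proof (intro conjI allI impI)
  show "torus_config 6 (X6 a)"
    by (rule torus_config_X6[OF a])
next
  fix y assume y: "torus_config 6 y \<and> same_perm_type 6 (X6 a) y"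
  define u v where "u k = fst (y k)" and "v k = snd (y k)" for k
  obtain \<sigma>1 \<sigma>2 where "perm_type 6 (X6 a) \<sigma>1 \<sigma>2" "perm_type 6 y \<sigma>1 \<sigma>2"
    using y by (auto simp: same_perm_type_def)
  note mono = perm_type_mono[OF this, folded u_def v_def]
  have u: "u 0 \<le> u 1" "u 1 \<le> u 2" "u 2 \<le> u 3" "u 3 \<le> u 4" "u 4 \<le> u 5"
    using a by (auto intro!: mono(1))
  have v: "v 0 \<le> v 3" "v 3 \<le> v 1" "v 1 \<le> v 5" "v 5 \<le> v 2" "v 2 \<le> v 4"
    using a by (auto intro!: mono(2))
  have "\<And>k. k < 6 \<Longrightarrow> y k \<in> {0..<1} \<times> {0..<1}"
    using y by (auto simp: torus_config_def)
  then have "0 \<le> u 0" "u 5 < 1" "0 \<le> v 0" "v 4 < 1"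
    by (simp_all add: mem_Times_iff u_def v_def)
  note ranges = a u v this
  define A B C D E where "A = h a" and "B = h (1/2 - a)" and "C = h (2 * a)"
    and "D = h (1/2 - 2 * a)" and "E = h (1/2)"
  define \<alpha> \<beta> \<gamma> \<delta> where "\<alpha> = h' a * B" and "\<beta> = h' (1/2 - a) * A" and "\<gamma> = h' (2 * a) * C"
    and "\<delta> = h' (1/2 - 2 * a) * E"
  note defs = A_def B_def C_def D_def E_def \<alpha>_def \<beta>_def \<gamma>_def \<delta>_def
  \<comment> \<open>The critical equation, solved for \<alpha>; substituting it makes the total
    coefficient of every coordinate vanish below.\<close>
  have \<alpha>_eq: "\<alpha> = \<beta> + \<delta> - \<gamma>"
    using crit by (simp add: slope_def defs)
  \<comment> \<open>The disjunction covers pairs whose second coordinates are in the opposite order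
    to their labels; \<open>f\<close> is even.\<close>
  have T: "ennreal (c + c1 * (s' - s) + c2 * (t' - t)) \<le> tensor_potential f (y k - y l)"
    if "u k - u l = s'" "v k - v l = t' \<or> v l - v k = t'"
      "0 < s \<and> s < 1 \<and> 0 \<le> s' \<and> s' < 1" "0 < t \<and> t < 1 \<and> 0 \<le> t' \<and> t' < 1"
      "c = h s * h t" "c1 = h' s * h t" "c2 = h s * h' t" for c c1 c2 s s' t t' k l
  proof -
    have "tensor_potential f (y k - y l) = f s' * f t'"
      using that(1,2) f_minus[of t']
      by (auto simp: tensor_potential_def u_def v_def case_prod_unfold)
    then show ?thesis
      using product_tangent[of s s' t t'] that by simp
  qed
  have "ennreal (X6_energy a) = 2 * ennreal (X6_energy a / 2)"
    by (simp flip: ennreal_numeral ennreal_mult')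
  \<comment> \<open>One tangent plane per pair, in the order of \<open>energy_6\<close>. Differences
    above 1/2 contribute minus signs since h'(1 - t) = -h'(t), and the coefficients 0 come from
    h'(1/2) = 0.\<close>
  also have "X6_energy a / 2 =
    (A * B + \<alpha> * (u 1 - u 0 - a) + \<beta> * (v 1 - v 0 - (1/2 - a))) +
    ((C * C + \<gamma> * (u 2 - u 0 - 2 * a) + (- \<gamma>) * (v 2 - v 0 - (1 - 2 * a))) +
    ((E * D + 0 * (u 3 - u 0 - 1/2) + \<delta> * (v 3 - v 0 - (1/2 - 2 * a))) +
    ((A * B + (- \<beta>) * (u 4 - u 0 - (1/2 + a)) + (- \<alpha>) * (v 4 - v 0 - (1 - a))) +
    ((D * E + (- \<delta>) * (u 5 - u 0 - (1/2 + 2 * a)) + 0 * (v 5 - v 0 - 1/2)) +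
    ((A * B + \<alpha> * (u 2 - u 1 - a) + \<beta> * (v 2 - v 1 - (1/2 - a))) +
    ((A * B + \<beta> * (u 3 - u 1 - (1/2 - a)) + \<alpha> * (v 1 - v 3 - a)) +
    ((E * E + 0 * (u 4 - u 1 - 1/2) + 0 * (v 4 - v 1 - 1/2)) +
    ((A * B + (- \<beta>) * (u 5 - u 1 - (1/2 + a)) + \<alpha> * (v 5 - v 1 - a)) +
    ((D * E + \<delta> * (u 3 - u 2 - (1/2 - 2 * a)) + 0 * (v 2 - v 3 - 1/2)) +
    ((A * B + \<beta> * (u 4 - u 2 - (1/2 - a)) + \<alpha> * (v 4 - v 2 - a)) +
    ((E * D + 0 * (u 5 - u 2 - 1/2) + \<delta> * (v 2 - v 5 - (1/2 - 2 * a))) +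
    ((A * B + \<alpha> * (u 4 - u 3 - a) + (- \<beta>) * (v 4 - v 3 - (1/2 + a))) +
    ((C * C + \<gamma> * (u 5 - u 3 - 2 * a) + \<gamma> * (v 5 - v 3 - 2 * a)) +
     (A * B + \<alpha> * (u 5 - u 4 - a) + \<beta> * (v 4 - v 5 - (1/2 - a))))))))))))))))"
    unfolding X6_energy_def defs(1-5)[symmetric] \<alpha>_eq by (simp add: algebra_simps)
  also have "2 * ennreal \<dots> \<le> energy (tensor_potential f) 6 y"
    unfolding energy_6[of "tensor_potential f", OF tensor_minus]
    by (intro mult_left_mono ennreal_add_le T) (use ranges in \<open>simp_all add: h_reflect h_half_plus h'_reflect h'_half_plus h'_half defs\<close>)
  finally show "energy (tensor_potential f) 6 (X6 a) \<le> energy (tensor_potential f) 6 y"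
    by (simp add: energy_X6[OF a])
qed

section \<open>The energy along the family, and the equation for a minimizing parameter\<close>

lemma DERIV_X6_energy:
  assumes "0 < a" "a < 1/4"
  shows "(X6_energy has_real_derivative 16 * slope a) (at a)"
  unfolding X6_energy_def[abs_def] slope_def
  using assms by (auto intro!: derivative_eq_intros simp: algebra_simps)

lemma X6_energy_nonneg:
  assumes "0 < a" "a < 1/4"
  shows "0 \<le> X6_energy a"
  using assms h_pos[of a] h_pos[of "1/2 - a"] h_pos[of "1/2 - 2 * a"] h_pos[of "1/2"]
  by (simp add: X6_energy_def)

lemma X6_energy_le:
  assumes min: "minimizer_in_perm_type (tensor_potential f) 6 (X6 a)"
    and a: "0 < a" "a < 1/4" and b: "0 < b" "b < 1/4"
  shows "X6_energy a \<le> X6_energy b"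
proof -
  have "energy (tensor_potential f) 6 (X6 a) \<le> energy (tensor_potential f) 6 (X6 b)"
    using min torus_config_X6[OF b] same_perm_type_X6[OF a b]
    by (simp add: minimizer_in_perm_type_def)
  then show ?thesis
    by (simp only: energy_X6[OF a] energy_X6[OF b] ennreal_le_iff[OF X6_energy_nonneg[OF b]])
qed

lemma slope_minimizer:
  assumes min: "minimizer_in_perm_type (tensor_potential f) 6 (X6 a)"
    and a: "0 < a" "a < 1/4"
  shows "slope a = 0"
proof -
  have "16 * slope a = 0"
  proof (rule DERIV_local_min[OF DERIV_X6_energy[OF a]])
    \<comment> \<open>This radius keeps b inside (0,1/4), where \<open>X6 b\<close> is a
      competitor.\<close>
    show "0 < min a (1/4 - a)"
      using a by simp
    show "\<forall>b. \<bar>a - b\<bar> < min a (1/4 - a) \<longrightarrow> X6_energy a \<le> X6_energy b"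
      by (auto intro!: X6_energy_le[OF min a])
  qed
  then show ?thesis by simp
qed

section \<open>Existence of a zero of \<open>slope\<close>\<close>

lemma slope_eighth: "slope (1/8) \<le> 0"
proof -
  \<comment> \<open>At a = 1/8 the arguments 2a and 1/2 - 2a coincide, so the second and fourth
    terms combine; the first and third are compared through the monotone quotient h'/h.\<close>
  have "h' (1/8) * h (3/8) \<le> h' (3/8) * h (1/8)"
    using log_slope_mono[of "1/8" "3/8"] h_pos[of "1/8"] h_pos[of "3/8"]
    by (simp add: divide_simps)
  moreover have "h' (1/4) * (h (1/4) - h (1/2)) \<le> 0"
    using h'_nonpos[of "1/4"] h_half_le[of "1/4"] by (intro mult_nonpos_nonneg) auto
  ultimately show ?thesis
    by (simp add: slope_def algebra_simps)
qed

text \<open>Near \<open>1/4\<close> the last term of the slope dominates: the first and third cancel in the limit, the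
  second vanishes since \<open>h' (1/2) = 0\<close>, and \<open>- h' (1/2 - 2 * b)\<close> stays away from \<open>0\<close>.\<close>

lemma slope_nonneg_near_quarter:
  assumes t: "0 < t" "t < 1/2" and neg: "h' t < 0"
  obtains b where "1/8 < b" "b < 1/4" "0 \<le> slope b"
proof -
  define \<psi> where "\<psi> b = h' b * h (1/2 - b) + h' (2 * b) * h (2 * b) - h' (1/2 - b) * h b" for b
  define \<kappa> where "\<kappa> = - h' t * h (1/2)"
  have \<kappa>: "0 < \<kappa>"
    using neg h_pos[of "1/2"] by (simp add: \<kappa>_def mult_neg_pos)
  have "isCont \<psi> (1/4)"
    unfolding \<psi>_def[abs_def]
    by (intro isCont_h_chain isCont_h'_chain continuous_intros) auto
  then have "(\<psi> \<longlongrightarrow> 0) (at_left (1/4))"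
    by (simp add: isCont_def \<psi>_def h'_half filterlim_at_split)
  then have "\<forall>\<^sub>F b in at_left (1/4). - \<kappa> < \<psi> b"
    using \<kappa> by (intro order_tendstoD(1)) auto
  moreover have "\<forall>\<^sub>F b in at_left (1/4). b \<in> {max (1/8) (1/4 - t / 2)<..<1/4}"
    using t by (intro eventually_at_leftI[of "max (1/8) (1/4 - t / 2)"]) (auto simp: max_def)
  ultimately have "\<forall>\<^sub>F b in at_left (1/4). - \<kappa> < \<psi> b \<and> b \<in> {max (1/8) (1/4 - t / 2)<..<1/4}"
    by (rule eventually_conj)
  then obtain b where b: "- \<kappa> < \<psi> b" "1/8 < b" "b < 1/4" "1/2 - 2 * b < t"
    using eventually_happens'[OF trivial_limit_at_left_real] by fastforce
  define s where "s = 1/2 - 2 * b"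
  have s: "0 < s" "s \<le> t" "s < 1"
    using b t by (auto simp: s_def)
  have pos: "0 < h s" "0 < h t"
    using s t by (auto intro: h_pos)
  \<comment> \<open>As s decreases, the negative quotient h'/h does not increase and h does not
    decrease, so h'(s) \<le> h'(t). This needs no limit of h' at 0, where \<open>f\<close> may be
    singular.\<close>
  have "h' s = h' s / h s * h s"
    using pos by simp
  also have "\<dots> \<le> h' t / h t * h s"
    using pos s t by (intro mult_right_mono log_slope_mono) auto
  also have "\<dots> \<le> h' t / h t * h t"
    using pos neg s t h_antimono[of s t] by (intro mult_left_mono_neg) (auto simp: divide_le_0_iff)
  also have "\<dots> = h' t"
    using pos by simp
  finally have "h' s * h (1/2) \<le> h' t * h (1/2)"
    using h_pos[of "1/2"] by (intro mult_right_mono) auto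
  then have "0 \<le> slope b"
    using b(1) by (simp add: slope_def \<psi>_def \<kappa>_def s_def)
  with b show thesis
    by (intro that)
qed

lemma slope_root:
  obtains a where "0 < a" "a < 1/4" "slope a = 0"
proof (cases "\<exists>t. 0 < t \<and> t < 1/2 \<and> h' t < 0")
  case True
  then obtain b where b: "1/8 < b" "b < 1/4" "0 \<le> slope b"
    using slope_nonneg_near_quarter by blast
  have "continuous_on {1/8..b} slope"
    unfolding slope_def[abs_def] using b
    by (intro continuous_at_imp_continuous_on ballI 
        isCont_h_chain isCont_h'_chain continuous_intros) auto
  then obtain a where "1/8 \<le> a" "a \<le> b" "slope a = 0"
    using IVT'[of slope "1/8" 0 b] slope_eighth b by auto
  then show thesis
    using b by (intro that[of a]) auto
next
  case False
  then have "h' t = 0" if "0 < t" "t < 1/2" for t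
    using h'_nonpos[of t] that by force
  \<comment> \<open>Here h' vanishes on (0,1/2), so every parameter in (0,1/4) is a zero; 1/8 is an
    arbitrary choice.\<close>
  then have "slope (1/8) = 0"
    by (simp add: slope_def)
  then show thesis
    by (intro that[of "1/8"]) auto
qed

section \<open>Uniqueness under strict logarithmic convexity\<close>

lemma strict_tangent:
  assumes strict: "strictly_log_convex f" and s: "0 < s" "s \<le> 1/2" and t: "0 < t" "t \<le> 1/2" and "s \<noteq> t"
  shows "ln (h s) + h' s / h s * (t - s) < ln (h t)"
proof -
  \<comment> \<open>The weak tangent inequality at the midpoint, combined with strict convexity
    there, gives the strict one at t.\<close>
  let ?m = "1/2 * s + 1/2 * t"
  have "\<forall>u>0. \<forall>v>0. u + v = 1 \<longrightarrow> ln (h (u * s + v * t)) < u * ln (h s) + v * ln (h t)"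
    using strict s t \<open>s \<noteq> t\<close> by (auto simp: strictly_log_convex_def strictly_convex_on_def)
  from this[rule_format, of "1/2" "1/2"]
  have "ln (h ?m) < 1/2 * ln (h s) + 1/2 * ln (h t)"
    by simp
  moreover have "ln (h s) + h' s / h s * (?m - s) \<le> ln (h ?m)"
    using s t by (intro tangent) auto
  moreover have "h' s / h s * (?m - s) = 1/2 * (h' s / h s * (t - s))"
    by (simp add: diff_divide_distrib algebra_simps)
  ultimately show ?thesis
    by linarith
qed

text \<open>Strictness comes from the products h(a) h(1/2 - a) alone; weak tangent inequalities
  suffice for the other terms.\<close>

lemma X6_energy_strict_tangent:
  assumes strict: "strictly_log_convex f" and a: "0 < a" "a < 1/4" and b: "0 < b" "b < 1/4" and "a \<noteq> b"
  shows "X6_energy a + 16 * slope a * (b - a) < X6_energy b"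
proof -
  let ?u = "h' a / h a * (b - a)" and ?v = "h' (1/2 - a) / h (1/2 - a) * (a - b)"
  have pos: "0 < h a" "0 < h (1/2 - a)" "0 < h b" "0 < h (1/2 - b)"
    using a b by (auto intro: h_pos)
  have "h a * h (1/2 - a) + h' a * h (1/2 - a) * (b - a) + h a * h' (1/2 - a) * (a - b) =
      h a * h (1/2 - a) * (1 + (?u + ?v))"
    using pos by (simp add: field_simps)
  also have "\<dots> \<le> h a * h (1/2 - a) * exp (?u + ?v)"
    using pos by (intro mult_left_mono exp_ge_add_one_self) auto
  also have "\<dots> = exp (ln (h a) + ?u + (ln (h (1/2 - a)) + ?v))"
    using pos by (simp only: exp_add exp_ln) (simp add: mult_ac)
  also have "\<dots> < exp (ln (h b) + ln (h (1/2 - b)))"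
    using strict_tangent[OF strict, of a b] strict_tangent[OF strict, of "1/2 - a" "1/2 - b"] a b \<open>a \<noteq> b\<close>
    by simp
  also have "\<dots> = h b * h (1/2 - b)"
    using pos by (simp add: exp_add)
  finally have 1: "h a * h (1/2 - a) + h' a * h (1/2 - a) * (b - a) + h a * h' (1/2 - a) * (a - b)
      < h b * h (1/2 - b)" .
  have 2: "h (2 * a) * h (2 * a) + h' (2 * a) * h (2 * a) * (2 * b - 2 * a) +
      h (2 * a) * h' (2 * a) * (2 * b - 2 * a) \<le> h (2 * b) * h (2 * b)"
    using a b by (intro product_tangent_real) auto
  have 3: "h (1/2) * h (1/2 - 2 * a) + h' (1/2) * h (1/2 - 2 * a) * (1/2 - 1/2) +
      h (1/2) * h' (1/2 - 2 * a) * ((1/2 - 2 * b) - (1/2 - 2 * a)) \<le> h (1/2) * h (1/2 - 2 * b)"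
    using a b by (intro product_tangent_real) auto
  show ?thesis
    using 1 2 3 unfolding X6_energy_def slope_def by (simp add: algebra_simps)
qed

lemma X6_minimizer_unique:
  assumes strict: "strictly_log_convex f"
    and a: "0 < a" "a < 1/4" "minimizer_in_perm_type (tensor_potential f) 6 (X6 a)"
    and b: "0 < b" "b < 1/4" "minimizer_in_perm_type (tensor_potential f) 6 (X6 b)"
  shows "a = b"
proof (rule ccontr)
  assume "a \<noteq> b"
  then have "X6_energy a < X6_energy b"
    using X6_energy_strict_tangent[OF strict a(1,2) b(1,2)] slope_minimizer[OF a(3,1,2)] by simp
  with X6_energy_le[OF b(3,1,2) a(1,2)] show False
    by simp
qed

end

theorem proposition5p4:
  fixes f :: "real \<Rightarrow> ennreal"
  assumes "potential f"
    and "real_val f differentiable_on {0<..<1}"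
    and "antimono_on {0<..1/2} f"
    and "log_convex f"
  shows "(\<exists>a\<in>{0<..<1/4}. minimizer_in_perm_type (tensor_potential f) 6 (X6 a)) \<and>
    (\<forall>a\<in>{0<..<1/4}. minimizer_in_perm_type (tensor_potential f) 6 (X6 a) \<longrightarrow>
       deriv (real_val f) a * real_val f (1/2 - a)
         + deriv (real_val f) (2 * a) * real_val f (2 * a)
       = deriv (real_val f) (1/2 - a) * real_val f a
         + deriv (real_val f) (1/2 - 2 * a) * real_val f (1/2)) \<and>
    (strictly_log_convex f \<longrightarrow>
       (\<exists>!a. a \<in> {0<..<1/4} \<and> minimizer_in_perm_type (tensor_potential f) 6 (X6 a)))"
proof -
  interpret log_convex_potential f
    by unfold_locales (fact assms)+
  obtain a where a: "0 < a" "a < 1/4" "slope a = 0"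
    by (rule slope_root)
  note min = X6_minimizer[OF a]
  show ?thesis
  proof (intro conjI ballI impI)
    show "\<exists>a\<in>{0<..<1/4}. minimizer_in_perm_type (tensor_potential f) 6 (X6 a)"
      using a min by auto
  next
    fix b :: real assume b: "b \<in> {0<..<1/4}" "minimizer_in_perm_type (tensor_potential f) 6 (X6 b)"
    then have "slope b = 0"
      by (intro slope_minimizer) auto
    then show "h' b * h (1/2 - b) + h' (2 * b) * h (2 * b)
        = h' (1/2 - b) * h b + h' (1/2 - 2 * b) * h (1/2)"
      by (simp add: slope_def)
  next
    assume "strictly_log_convex f"
    then show "\<exists>!a. a \<in> {0<..<1/4} \<and> minimizer_in_perm_type (tensor_potential f) 6 (X6 a)"
      using a min X6_minimizer_unique by (intro ex1I[of _ a]) auto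
  qed
qed

end
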